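(* Let $\alpha$ be a set with an involution $\tau\colon\alpha\to\alpha$, and let $\beta\subset\alpha$ be a subset such that $\tau(\beta)=\beta$. For any $k,l\in\mathbb{Z}/3\mathbb{Z}$, the number of tricolorings (with respect to $\beta$) of a nanoword $w$ over $\alpha$ with input $k$ and output $l$ is a homotopy invariant of $w$.
   Context: Fix a set $\alpha$ with an involution $\tau\colon\alpha\to\alpha$. An $\alpha$-alphabet is a set $\mathcal{A}$ with a map $\mathcal{A}\to\alpha$, $A\mapsto|A|$. A nanoword over $\alpha$ is a pair $(\mathcal{A},w)$, where $\mathcal{A}$ is a finite $\alpha$-alphabet and $w$ is a word (finite sequence) in letters of $\mathcal{A}$ in which every letter of $\mathcal{A}$ appears exactly twice. Two nanowords are isomorphic if there is a bijection of their alphabets commuting with the maps to $\alpha$ that sends the first word letterwise to the second. Homotopy of nanowords is the equivalence relation generated by isomorphisms and the following three moves and their inverses: (i) $(\mathcal{A},xAAy)\mapsto(\mathcal{A}-\{A\},xy)$, where $x,y$ are words on $\mathcal{A}-\{A\}$; (ii) $(\mathcal{A},xAByBAz)\mapsto(\mathcal{A}-\{A,B\},xyz)$ if $|A|=\tau(|B|)$, where $x,y,z$ are words on $\mathcal{A}-\{A,B\}$; (iii) $(\mathcal{A},xAByACzBCt)\mapsto(\mathcal{A},xBAyCAzCBt)$ if $|A|=|B|=|C|$, where $x,y,z,t$ are words on $\mathcal{A}-\{A,B,C\}$. Here $A$, $B$, $C$ are distinct letters of $\mathcal{A}$. A quantity is a homotopy invariant if it takes equal values on homotopic nanowords. Let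 $(\mathcal{A},w)$ be a nanoword of length $n$. For $A\in\mathcal{A}$ let $i_A<j_A$ be the two positions (in $\{1,\dots,n\}$) at which $A$ occurs in $w$. A tricoloring of $w$ (with respect to $\beta$) is a function $f\colon\{0,1,\dots,n\}\to\mathbb{Z}/3\mathbb{Z}$ such that for every $A\in\mathcal{A}$: if $|A|\in\beta$, then $f(i_A)=f(i_A-1)$ and $f(j_A-1)+f(j_A)+f(i_A)=0$; and if $|A|\in\alpha-\beta$, then $f(j_A)=f(j_A-1)$ and $f(i_A-1)+f(i_A)+f(j_A)=0$. The input of $f$ is $f(0)$ and the output of $f$ is $f(n)$. *)

theory Defs
  imports "HOL-Library.Numeral_Type" "HOL-Library.FuncSet"
begin

text \<open>
  A set \<open>\<alpha>\<close> is given as a carrier \<open>\<alpha> :: 'c set\<close>, so that \<open>\<alpha>\<close> may be empty; the values of \<open>\<tau>\<close>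
  outside \<open>\<alpha>\<close> are irrelevant.
\<close>

definition involution_on :: "'c set \<Rightarrow> ('c \<Rightarrow> 'c) \<Rightarrow> bool" where
  "involution_on \<alpha> \<tau> \<longleftrightarrow> (\<forall>a\<in>\<alpha>. \<tau> a \<in> \<alpha> \<and> \<tau> (\<tau> a) = a)"

text \<open>
  The field \<open>proj\<close> is the map \<open>A \<mapsto> |A|\<close>. Only its values on \<open>letters\<close> are meaningful: nanowords that
  differ in \<open>proj\<close> outside \<open>letters\<close> are isomorphic in the sense of \<open>nanoword_iso\<close> below.
\<close>

record ('l, 'c) nanoword =
  letters :: "'l set"
  proj :: "'l \<Rightarrow> 'c"
  word :: "'l list"

definition is_nanoword :: "'c set \<Rightarrow> ('l, 'c) nanoword \<Rightarrow> bool" where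
  "is_nanoword \<alpha> N \<longleftrightarrow>
     finite (letters N) \<and>
     (\<forall>A\<in>letters N. proj N A \<in> \<alpha>) \<and>
     set (word N) \<subseteq> letters N \<and>
     (\<forall>A\<in>letters N. count_list (word N) A = 2)"

definition nanoword_iso :: "('l, 'c) nanoword \<Rightarrow> ('l, 'c) nanoword \<Rightarrow> bool" where
  "nanoword_iso N M \<longleftrightarrow>
     (\<exists>h. bij_betw h (letters N) (letters M) \<and>
          (\<forall>A\<in>letters N. proj M (h A) = proj N A) \<and>
          word M = map h (word N))"

text \<open>
  All letters are drawn from one type \<open>'l\<close>, which plays the role of the universe of sets. Every chain
  of moves can be relabelled to use letters of any given infinite type, so for infinite \<open>'l\<close> this is
  homotopy over arbitrary finite alphabets.
\<close>

inductive homotopy_step ::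
    "'c set \<Rightarrow> ('c \<Rightarrow> 'c) \<Rightarrow> ('l, 'c) nanoword \<Rightarrow> ('l, 'c) nanoword \<Rightarrow> bool"
  for \<alpha> :: "'c set" and \<tau> :: "'c \<Rightarrow> 'c" where
  iso:
    "homotopy_step \<alpha> \<tau> N M"
    if "is_nanoword \<alpha> N" "is_nanoword \<alpha> M" "nanoword_iso N M"
| move1:
    "homotopy_step \<alpha> \<tau>
       \<lparr>letters = L, proj = p, word = x @ [A, A] @ y\<rparr>
       \<lparr>letters = L - {A}, proj = p, word = x @ y\<rparr>"
    if "is_nanoword \<alpha> \<lparr>letters = L, proj = p, word = x @ [A, A] @ y\<rparr>"
       "A \<in> L" "set x \<union> set y \<subseteq> L - {A}"
| move2:
    "homotopy_step \<alpha> \<tau>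
       \<lparr>letters = L, proj = p, word = x @ [A, B] @ y @ [B, A] @ z\<rparr>
       \<lparr>letters = L - {A, B}, proj = p, word = x @ y @ z\<rparr>"
    if "is_nanoword \<alpha> \<lparr>letters = L, proj = p, word = x @ [A, B] @ y @ [B, A] @ z\<rparr>"
       "A \<in> L" "B \<in> L" "A \<noteq> B" "p A = \<tau> (p B)"
       "set x \<union> set y \<union> set z \<subseteq> L - {A, B}"
| move3:
    "homotopy_step \<alpha> \<tau>
       \<lparr>letters = L, proj = p, word = x @ [A, B] @ y @ [A, C] @ z @ [B, C] @ t\<rparr>
       \<lparr>letters = L, proj = p, word = x @ [B, A] @ y @ [C, A] @ z @ [C, B] @ t\<rparr>"
    if "is_nanoword \<alpha> \<lparr>letters = L, proj = p, word = x @ [A, B] @ y @ [A, C] @ z @ [B, C] @ t\<rparr>"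
       "A \<in> L" "B \<in> L" "C \<in> L" "A \<noteq> B" "A \<noteq> C" "B \<noteq> C" "p A = p B" "p B = p C"
       "set x \<union> set y \<union> set z \<union> set t \<subseteq> L - {A, B, C}"

definition homotopic ::
    "'c set \<Rightarrow> ('c \<Rightarrow> 'c) \<Rightarrow> ('l, 'c) nanoword \<Rightarrow> ('l, 'c) nanoword \<Rightarrow> bool" where
  "homotopic \<alpha> \<tau> = equivclp (homotopy_step \<alpha> \<tau>)"

text \<open>
  Positions are counted from 1, whereas list indexing starts at 0, so the letter at position \<open>i\<close> is
  \<open>word N ! (i - 1)\<close>. As every letter of a nanoword occurs exactly twice, the pair \<open>i < j\<close> below is
  \<open>(i\<^sub>A, j\<^sub>A)\<close>. The numeral type \<open>3\<close> is the ring of integers modulo 3.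
\<close>

definition is_tricoloring ::
    "'c set \<Rightarrow> 'c set \<Rightarrow> ('l, 'c) nanoword \<Rightarrow> (nat \<Rightarrow> 3) \<Rightarrow> bool" where
  "is_tricoloring \<alpha> \<beta> N f \<longleftrightarrow>
     (\<forall>A\<in>letters N. \<forall>i\<in>{1..length (word N)}. \<forall>j\<in>{1..length (word N)}.
        i < j \<and> word N ! (i - 1) = A \<and> word N ! (j - 1) = A \<longrightarrow>
          (proj N A \<in> \<beta> \<longrightarrow>
             f i = f (i - 1) \<and> f (j - 1) + f j + f i = 0) \<and>
          (proj N A \<in> \<alpha> - \<beta> \<longrightarrow>
             f j = f (j - 1) \<and> f (i - 1) + f i + f j = 0))"

text \<open>
  A function on \<open>{0..n}\<close> is represented by its unique extension that is \<open>undefined\<close> elsewhere.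
\<close>

definition tricolorings ::
    "'c set \<Rightarrow> 'c set \<Rightarrow> ('l, 'c) nanoword \<Rightarrow> 3 \<Rightarrow> 3 \<Rightarrow> (nat \<Rightarrow> 3) set" where
  "tricolorings \<alpha> \<beta> N k l =
     {f \<in> {0..length (word N)} \<rightarrow>\<^sub>E UNIV.
        is_tricoloring \<alpha> \<beta> N f \<and> f 0 = k \<and> f (length (word N)) = l}"

end

theory Submission
  imports Defs
begin

text \<open>
  Read the word from left to right, carrying a state in \<open>\<int>/3\<close> that starts at the input. Each letter \<open>A\<close>
  is met twice. At one of the two places, the over-passage, the conditions on a tricoloring say that
  the state does not change, and its value there may be called the value \<open>c A\<close> of the letter. At the
  other place, the under-passage, they say that the state \<open>s\<close> becomes \<open>- s - c A\<close>, the reflection of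
  \<open>s\<close> in \<open>c A\<close>, as in Fox's 3-colorings of knot diagrams. The over-passage comes first exactly if
  \<open>|A| \<in> \<beta>\<close>. So a tricoloring with prescribed input and output is the same thing as an assignment
  \<open>c\<close> of values to letters for which the reading does not fail at an over-passage and ends in the
  prescribed output (\<open>card_tricolorings\<close>).

  For assignments the moves can be compared locally, since the parts of the word outside the move
  act on the state in the same way before and after it.
  \<^item> In \<open>AA\<close> the value of \<open>A\<close> must be the state at that point, and then the state does not change
    (\<open>run_move1\<close>).
  \<^item> In \<open>AB\<dots>BA\<close>, where \<open>\<tau>(\<beta>) = \<beta>\<close> puts \<open>|A|\<close> and \<open>|B|\<close> on the same side of \<open>\<beta>\<close>, both values must
    be the state at the over-passages; the two reflections are then equal and cancel
    (\<open>run_move2\<close>).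
  \<^item> In the third move the moved strand changes its color by the quandle relation: replacing one value,
    \<open>c C\<close> or \<open>c A\<close> according to the side of \<open>\<beta>\<close>, by \<open>- c A - c C\<close> turns assignments for one word
    into assignments for the other, and doing so twice gives back \<open>c\<close> (\<open>run_move3\<close>).

  In the first two moves each assignment for the smaller alphabet thus has exactly one extension
  (\<open>card_forced_extensions\<close>), and in the third there is a bijection. An isomorphism does not change the
  set of tricolorings at all.
\<close>

section \<open>Assignments of residues to letters\<close>

text \<open>
  The state after reading a word from the state \<open>s\<close>, or \<open>None\<close> if an over-passage of some letter is
  reached in a state other than its value. The set \<open>S\<close> contains the letters met before, so that
  \<open>A \<notin> S\<close> recognizes a first occurrence; \<open>b A\<close> tells whether the over-passage of \<open>A\<close> comes first.
  Keeping \<open>S\<close> explicit lets the reading be cut at any place of the word.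
\<close>

fun run :: "('l \<Rightarrow> bool) \<Rightarrow> ('l \<Rightarrow> 3) \<Rightarrow> 'l set \<Rightarrow> 'l list \<Rightarrow> 3 \<Rightarrow> 3 option" where
  "run b c S [] s = Some s"
| "run b c S (A # w) s =
     (if (A \<notin> S) = b A
      then if s = c A then run b c (insert A S) w s else None
      else run b c (insert A S) w (- s - c A))"

lemma run_append:
  "run b c S (v @ w) s = Option.bind (run b c S v s) (run b c (S \<union> set v) w)"
  by (induction v arbitrary: S s) auto

lemma run_cong:
  assumes "\<And>A. A \<in> set w \<Longrightarrow> c A = c' A" "\<And>A. A \<in> set w \<Longrightarrow> A \<in> S \<longleftrightarrow> A \<in> S'"
  shows "run b c S w s = run b c' S' w s"
  using assms
proof (induction w arbitrary: S S' s)
  case (Cons A w)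
  have "run b c (insert A S) w u = run b c' (insert A S') w u" for u
    using Cons.prems by (intro Cons.IH) auto
  then show ?case using Cons.prems by simp
qed simp

definition passes :: "bool \<Rightarrow> 3 \<Rightarrow> 3 \<Rightarrow> 3 \<Rightarrow> bool" where
  "passes over a s s' \<longleftrightarrow> (if over then s = a \<and> s' = a else s' = - s - a)"

lemma passes_deterministic: "passes over a s s' \<Longrightarrow> passes over a s s'' \<Longrightarrow> s' = s''"
  by (simp add: passes_def split: if_splits)

text \<open>
  The functions \<open>f\<close> that list the states of a successful reading, \<open>f t\<close> being the state after \<open>t\<close>
  letters.
\<close>

definition traces :: "('l \<Rightarrow> bool) \<Rightarrow> ('l \<Rightarrow> 3) \<Rightarrow> 'l set \<Rightarrow> 'l list \<Rightarrow> (nat \<Rightarrow> 3) \<Rightarrow> bool" where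
  "traces b c S w f \<longleftrightarrow> (\<forall>t<length w.
     passes ((w ! t \<notin> S \<union> set (take t w)) = b (w ! t)) (c (w ! t)) (f t) (f (Suc t)))"

lemma traces_Cons:
  "traces b c S (A # w) f \<longleftrightarrow>
     passes ((A \<notin> S) = b A) (c A) (f 0) (f 1) \<and> traces b c (insert A S) w (\<lambda>t. f (Suc t))"
  unfolding traces_def by (auto simp: All_less_Suc2 conj_ac)

lemma run_eq_Some_iff:
  "run b c S w s = Some l \<longleftrightarrow> (\<exists>f. traces b c S w f \<and> f 0 = s \<and> f (length w) = l)"
proof (induction w arbitrary: S s)
  case Nil
  show ?case by (auto simp: traces_def)
next
  case (Cons A w)
  have "run b c S (A # w) s = Some l \<longleftrightarrow>
      (\<exists>s'. passes ((A \<notin> S) = b A) (c A) s s' \<and> run b c (insert A S) w s' = Some l)"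
    by (auto simp: passes_def)
  also have "\<dots> \<longleftrightarrow> (\<exists>s' g. passes ((A \<notin> S) = b A) (c A) s s' \<and>
      traces b c (insert A S) w g \<and> g 0 = s' \<and> g (length w) = l)"
    using Cons.IH by blast
  also have "\<dots> \<longleftrightarrow> (\<exists>f. traces b c S (A # w) f \<and> f 0 = s \<and> f (length (A # w)) = l)"
    (is "?L \<longleftrightarrow> ?R")
  proof
    assume ?L
    then obtain g where "passes ((A \<notin> S) = b A) (c A) s (g 0)"
      "traces b c (insert A S) w g" "g (length w) = l" by blast
    then have "traces b c S (A # w) (case_nat s g) \<and> case_nat s g 0 = s
        \<and> case_nat s g (length (A # w)) = l"
      by (simp add: traces_Cons)
    then show ?R by blast
  next
    assume ?R
    then obtain f where "traces b c S (A # w) f" "f 0 = s" "f (length (A # w)) = l" by blast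
    then show ?L
      by (intro exI[of _ "f 1"] exI[of _ "\<lambda>t. f (Suc t)"]) (auto simp: traces_Cons)
  qed
  finally show ?case .
qed

definition assignments ::
    "('l \<Rightarrow> bool) \<Rightarrow> 'l set \<Rightarrow> 'l list \<Rightarrow> 3 \<Rightarrow> 3 \<Rightarrow> ('l \<Rightarrow> 3) set" where
  "assignments b L w k l = {c \<in> L \<rightarrow>\<^sub>E UNIV. run b c {} w k = Some l}"

section \<open>Tricolorings as assignments\<close>

lemma count_list_2_positions:
  assumes "count_list w A = 2"
  obtains i j where "i < j" "j < length w" "w ! i = A" "w ! j = A"
    "\<And>t. t < length w \<Longrightarrow> w ! t = A \<Longrightarrow> t = i \<or> t = j"
proof -
  have "A \<in> set w" using assms by (metis count_notin zero_neq_numeral)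
  then obtain x v where v: "w = x @ A # v" "A \<notin> set x" by (metis split_list_first)
  then have "count_list v A = 1" using assms by simp
  then have "A \<in> set v" by (metis count_notin zero_neq_one)
  then obtain y z where z: "v = y @ A # z" "A \<notin> set y" by (metis split_list_first)
  with \<open>count_list v A = 1\<close> have "A \<notin> set z" by (simp add: count_list_0_iff)
  show thesis
  proof (rule that[of "length x" "Suc (length x + length y)"])
    fix t assume t: "t < length w" "w ! t = A"
    show "t = length x \<or> t = Suc (length x + length y)"
    proof (rule ccontr)
      assume "\<not> ?thesis"
      then consider "t < length x" | u where "t = length x + Suc u" "u < length y"
        | u where "t = length x + Suc (length y + Suc u)" "u < length z"
      proof -
        assume a: "\<not> (t = length x \<or> t = Suc (length x + length y))"
        have l: "length w = length x + length y + length z + 2" using v z by simp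
        consider "t < length x" | "length x < t" "t < Suc (length x + length y)"
          | "Suc (length x + length y) < t" using a by linarith
        then show thesis
        proof cases
          case 1 then show thesis using that(1) by blast
        next
          case 2 then show thesis using that(2)[of "t - Suc (length x)"] by simp
        next
          case 3 then show thesis
            using that(3)[of "t - Suc (Suc (length x + length y))"] t(1) l by simp
        qed
      qed
      then show False
        by cases (use v z t \<open>A \<notin> set z\<close> in \<open>auto simp: nth_append in_set_conv_nth\<close>)
    qed
  qed (use v z in \<open>auto simp: nth_append\<close>)
qed

lemma nanoword_positions:
  assumes "is_nanoword \<alpha> N"
  obtains I J where
    "\<And>A. A \<in> letters N \<Longrightarrow> I A < J A \<and> J A < length (word N) \<and> word N ! I A = A \<and> word N ! J A = A
      \<and> (\<forall>t<length (word N). word N ! t = A \<longrightarrow> t = I A \<or> t = J A)"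
proof -
  define P where "P A i j \<longleftrightarrow> i < j \<and> j < length (word N) \<and> word N ! i = A \<and> word N ! j = A
      \<and> (\<forall>t<length (word N). word N ! t = A \<longrightarrow> t = i \<or> t = j)" for A i j
  have "\<exists>i j. P A i j" if "A \<in> letters N" for A
  proof -
    have "count_list (word N) A = 2" using assms that by (simp add: is_nanoword_def)
    then show ?thesis unfolding P_def by (rule count_list_2_positions) blast
  qed
  then obtain I J where "P A (I A) (J A)" if "A \<in> letters N" for A by metis
  then show thesis unfolding P_def by (rule that)
qed

lemma add3_eq_0_iff: "(x::3) + y + z = 0 \<longleftrightarrow> y = - x - z"
  by (auto simp: algebra_simps eq_neg_iff_add_eq_0)

text \<open>
  Tricolorings and assignments are the two projections of the set of pairs \<open>(f, c)\<close> in which \<open>f\<close> lists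
  the states of the reading with values \<open>c\<close>. Both projections are injective: \<open>f\<close> determines \<open>c\<close>,
  because every letter has an over-passage, and \<open>c\<close> determines \<open>f\<close>, because the reading is
  deterministic once the input is fixed.
\<close>

lemma card_tricolorings:
  fixes N :: "('l, 'c) nanoword"
  assumes N: "is_nanoword \<alpha> N"
  shows "card (tricolorings \<alpha> \<beta> N k l) =
    card (assignments (\<lambda>A. proj N A \<in> \<beta>) (letters N) (word N) k l)"
proof -
  define w where "w = word N"
  define L where "L = letters N"
  define b where "b = (\<lambda>A. proj N A \<in> \<beta>)"
  define n where "n = length w"
  obtain I J where "\<And>A. A \<in> L \<Longrightarrow> I A < J A \<and> J A < n \<and> w ! I A = A \<and> w ! J A = A
      \<and> (\<forall>t<n. w ! t = A \<longrightarrow> t = I A \<or> t = J A)"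
    using nanoword_positions[OF N, folded w_def L_def n_def] by blast
  then have IJ: "I A < J A" "I A < n" "J A < n" "w ! I A = A" "w ! J A = A"
      "\<And>t. t < n \<Longrightarrow> w ! t = A \<Longrightarrow> t = I A \<or> t = J A" if "A \<in> L" for A
    using that by (blast intro: less_trans)+
  have wL: "w ! t \<in> L" if "t < n" for t
    using N that nth_mem unfolding is_nanoword_def w_def L_def n_def by blast
  have first: "A \<notin> set (take (I A) w)" and second: "A \<in> set (take (J A) w)" if "A \<in> L" for A
  proof -
    show "A \<notin> set (take (I A) w)"
    proof
      assume "A \<in> set (take (I A) w)"
      then obtain t where "t < n" "t < I A" "w ! t = A" by (auto simp: in_set_conv_nth n_def)
      then show False using IJ(1,6)[OF that] by fastforce
    qed
    show "A \<in> set (take (J A) w)"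
      using IJ[OF that] by (auto simp: in_set_conv_nth n_def intro!: exI[of _ "I A"])
  qed
  (* Grouped by letters instead of positions, the conditions on a trace have the shape of those on a
     tricoloring. *)
  have tr: "traces b c {} w f \<longleftrightarrow>
      (\<forall>A\<in>L. passes (b A) (c A) (f (I A)) (f (Suc (I A))) \<and>
             passes (\<not> b A) (c A) (f (J A)) (f (Suc (J A))))" for c f
  proof
    assume *: "traces b c {} w f"
    show "\<forall>A\<in>L. passes (b A) (c A) (f (I A)) (f (Suc (I A))) \<and>
             passes (\<not> b A) (c A) (f (J A)) (f (Suc (J A)))"
    proof
      fix A assume A: "A \<in> L"
      show "passes (b A) (c A) (f (I A)) (f (Suc (I A))) \<and>
             passes (\<not> b A) (c A) (f (J A)) (f (Suc (J A)))"
        using *[unfolded traces_def, rule_format, of "I A"]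
          *[unfolded traces_def, rule_format, of "J A"] IJ(2-5)[OF A] first[OF A] second[OF A]
        by (simp add: n_def)
    qed
  next
    assume *: "\<forall>A\<in>L. passes (b A) (c A) (f (I A)) (f (Suc (I A))) \<and>
             passes (\<not> b A) (c A) (f (J A)) (f (Suc (J A)))"
    show "traces b c {} w f"
      unfolding traces_def
    proof (intro allI impI)
      fix t assume "t < length w"
      then have t: "t < n" by (simp add: n_def)
      note A = wL[OF t]
      have "t = I (w ! t) \<or> t = J (w ! t)" using IJ(6)[OF A t] by simp
      then show "passes ((w ! t \<notin> {} \<union> set (take t w)) = b (w ! t)) (c (w ! t)) (f t) (f (Suc t))"
        using * A first[OF A] second[OF A] by fastforce
    qed
  qed
  have col: "is_tricoloring \<alpha> \<beta> N f \<longleftrightarrow>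
      (\<forall>A\<in>L. if b A then f (Suc (I A)) = f (I A) \<and> f (J A) + f (Suc (J A)) + f (Suc (I A)) = 0
        else f (Suc (J A)) = f (J A) \<and> f (I A) + f (Suc (I A)) + f (Suc (J A)) = 0)" for f
  proof -
    (* Positions in a tricoloring are counted from 1, those of I and J from 0. *)
    have pos: "(\<forall>i\<in>{1..n}. \<forall>j\<in>{1..n}. i < j \<and> w ! (i - 1) = A \<and> w ! (j - 1) = A \<longrightarrow> P i j)
        \<longleftrightarrow> P (Suc (I A)) (Suc (J A))" if A: "A \<in> L" for A P
    proof -
      have "i = Suc (I A) \<and> j = Suc (J A)"
        if "i \<in> {1..n}" "j \<in> {1..n}" "i < j" "w ! (i - 1) = A" "w ! (j - 1) = A" for i j
        using IJ(6)[OF A, of "i - 1"] IJ(6)[OF A, of "j - 1"] IJ(1)[OF A] that by fastforce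
      then show ?thesis using IJ(1-5)[OF A] by fastforce
    qed
    have "proj N A \<in> \<alpha>" if "A \<in> L" for A using N that by (simp add: is_nanoword_def L_def)
    then show ?thesis
      unfolding is_tricoloring_def w_def[symmetric] L_def[symmetric] n_def[symmetric]
      by (intro ball_cong refl) (simp add: pos b_def del: One_nat_def)
  qed
  define T where "T = {(f, c). f \<in> {0..n} \<rightarrow>\<^sub>E UNIV \<and> c \<in> L \<rightarrow>\<^sub>E UNIV \<and>
    f 0 = k \<and> f n = l \<and> traces b c {} w f}"
  have "inj_on fst T"
  proof (rule inj_onI, clarify)
    fix f c f' c' assume "(f, c) \<in> T" "(f', c') \<in> T" and eq: "fst (f, c) = fst (f', c')"
    then have c: "c \<in> L \<rightarrow>\<^sub>E UNIV" "c' \<in> L \<rightarrow>\<^sub>E UNIV"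
        "traces b c {} w f" "traces b c' {} w f" by (auto simp: T_def)
    have "c A = c' A" if "A \<in> L" for A
      using c(3,4) that unfolding tr passes_def by (cases "b A") force+
    then have "c = c'" using c(1,2) by (metis PiE_ext)
    then show "f = f' \<and> c = c'" using eq by simp
  qed
  moreover have "fst ` T = tricolorings \<alpha> \<beta> N k l"
  proof -
    have "is_tricoloring \<alpha> \<beta> N f \<longleftrightarrow> (\<exists>c\<in>L \<rightarrow>\<^sub>E UNIV. traces b c {} w f)" for f
    proof
      assume *: "is_tricoloring \<alpha> \<beta> N f"
      define c where "c = restrict (\<lambda>A. if b A then f (I A) else f (J A)) L"
      have "traces b c {} w f"
        using * unfolding col tr passes_def c_def
        by (auto simp: add3_eq_0_iff split: if_splits)
      moreover have "c \<in> L \<rightarrow>\<^sub>E UNIV" by (auto simp: c_def)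
      ultimately show "\<exists>c\<in>L \<rightarrow>\<^sub>E UNIV. traces b c {} w f" by blast
    next
      assume "\<exists>c\<in>L \<rightarrow>\<^sub>E UNIV. traces b c {} w f"
      then show "is_tricoloring \<alpha> \<beta> N f"
        unfolding col tr passes_def by (auto simp: add3_eq_0_iff split: if_splits)
    qed
    then have "tricolorings \<alpha> \<beta> N k l = {f. \<exists>c. (f, c) \<in> T}"
      unfolding tricolorings_def T_def w_def[symmetric] n_def[symmetric] by blast
    then show ?thesis by (simp add: Domain_fst[symmetric] Domain_unfold)
  qed
  moreover have "inj_on snd T"
  proof (rule inj_onI, clarify)
    fix f c f' c' assume "(f, c) \<in> T" "(f', c') \<in> T" and eq: "snd (f, c) = snd (f', c')"
    then have f: "f \<in> {0..n} \<rightarrow>\<^sub>E UNIV" "f' \<in> {0..n} \<rightarrow>\<^sub>E UNIV" "f 0 = f' 0"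
        "traces b c {} w f" "traces b c {} w f'" by (auto simp: T_def)
    have "f t = f' t" if "t \<le> n" for t
      using that
    proof (induction t)
      case (Suc t)
      then have t: "t < length w" "f t = f' t" by (auto simp: n_def)
      have "passes ((w ! t \<notin> {} \<union> set (take t w)) = b (w ! t)) (c (w ! t)) (f t) (f (Suc t))"
        using f(4) t(1) unfolding traces_def by blast
      moreover have
        "passes ((w ! t \<notin> {} \<union> set (take t w)) = b (w ! t)) (c (w ! t)) (f' t) (f' (Suc t))"
        using f(5) t(1) unfolding traces_def by blast
      ultimately show ?case unfolding t(2) by (rule passes_deterministic)
    qed (use f in simp)
    then have "f = f'" using f(1,2) by (auto intro: PiE_ext)
    then show "f = f' \<and> c = c'" using eq by simp
  qed
  moreover have "snd ` T = assignments b L w k l"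
  proof
    show "snd ` T \<subseteq> assignments b L w k l"
      by (auto simp: T_def assignments_def run_eq_Some_iff n_def)
    show "assignments b L w k l \<subseteq> snd ` T"
    proof
      fix c assume "c \<in> assignments b L w k l"
      then obtain f where c: "c \<in> L \<rightarrow>\<^sub>E UNIV"
        and f: "traces b c {} w f" "f 0 = k" "f n = l"
        by (auto simp: assignments_def run_eq_Some_iff n_def)
      have "(restrict f {0..n}, c) \<in> T"
        using c f by (auto simp: T_def traces_def n_def)
      then show "c \<in> snd ` T" by force
    qed
  qed
  ultimately have "card (tricolorings \<alpha> \<beta> N k l) = card (assignments b L w k l)"
    using card_image[of fst T] card_image[of snd T] by simp
  then show ?thesis unfolding b_def w_def L_def .
qed

section \<open>The moves\<close>

lemma triple_eq_0: "(x::3) + x + x = 0"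
proof -
  have "x + x + x = 3 * x" by simp
  also have "(3::3) = 0" by simp
  finally show ?thesis by simp
qed

text \<open>The reflection \<open>- s - a\<close> equals \<open>2 * a - s\<close> because \<open>3 = 0\<close>, so a point reflected in itself is fixed.\<close>

lemma neg_double: "- (x::3) - x = x"
  using triple_eq_0[of x] by (metis add_diff_cancel_right' diff_0)

lemma neg_diff_eq_iff: "- (x::3) - a = y \<longleftrightarrow> x = - y - a"
proof
  show "x = - y - a" if "- x - a = y" using that by (simp flip: that)
  show "- x - a = y" if "x = - y - a" using that by simp
qed

text \<open>
  Whichever of the two passages comes first, the over-passage demands \<open>c A\<close> to be the state after \<open>x\<close>:
  if it comes second, the reflected state \<open>- s - c A\<close> equals \<open>c A\<close> only for \<open>s = c A\<close>.
\<close>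

lemma run_move1:
  assumes "A \<notin> set x" "A \<notin> set y"
  shows "run b c {} (x @ [A, A] @ y) k = Some l \<longleftrightarrow>
    run b c {} (x @ y) k = Some l \<and> c A = the (run b c {} x k)"
proof -
  have y: "run b c (insert A (set x)) y s = run b c (set x) y s" for s
    using assms by (intro run_cong) auto
  have "- s - a = a \<longleftrightarrow> s = a" for s a :: 3
    using neg_diff_eq_iff[of s a a] neg_double[of a] by simp
  then show ?thesis
    using assms by (cases "run b c {} x k") (auto simp: run_append y neg_double)
qed

text \<open>
  If over-passages come first, the first two letters force both values to be the state after \<open>x\<close>;
  if they come second, the last two letters force both values to be the state after \<open>x\<close> and \<open>y\<close>.
  In either case \<open>c A = c B\<close>, so the two reflections, which compose to a shift by \<open>c A - c B\<close> or its
  negative, cancel.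
\<close>

lemma run_move2:
  assumes "b A = b B" "A \<noteq> B" "A \<notin> set x \<union> set y \<union> set z" "B \<notin> set x \<union> set y \<union> set z"
  shows "run b c {} (x @ [A, B] @ y @ [B, A] @ z) k = Some l \<longleftrightarrow>
    run b c {} (x @ y @ z) k = Some l \<and>
    (\<forall>D\<in>{A, B}. c D = the (run b c {} (if b A then x else x @ y) k))"
proof -
  have y: "run b c (insert B (insert A (set x))) y s = run b c (set x) y s" for s
    using assms by (intro run_cong) auto
  have z: "run b c (insert B (insert A (set x \<union> set y))) z s = run b c (set x \<union> set y) z s" for s
    using assms by (intro run_cong) auto
  have s: "insert A (insert B (insert B (insert A (set x)) \<union> set y))
    = insert B (insert A (set x \<union> set y))"
    "insert A (insert B (insert A (set x \<union> set y))) = insert B (insert A (set x \<union> set y))"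
    by auto
  show ?thesis
  proof (cases "run b c {} x k")
    case (Some u)
    show ?thesis
    proof (cases "b A")
      case True
      then show ?thesis using assms Some
        by (cases "run b c (set x) y u") (auto simp: run_append y z s)
    next
      case False
      (* The state in which y is read, while the values are not yet known to be equal. *)
      have c: "- (- u - c A) - c B = u + c A - c B" by simp
      show ?thesis
      proof (cases "c A = c B")
        case True
        then show ?thesis using assms Some False
          by (cases "run b c (set x) y u") (auto simp: run_append y z s c)
      next
        case neq: False
        then show ?thesis using assms Some False
          by (auto simp: run_append y z s c split: bind_splits)
      qed
    qed
  qed (simp add: run_append)
qed

text \<open>
  The pair of \<open>A\<close> and \<open>C\<close> is read with one passage over and one under. Its order decides whether the
  over-passage meets the state before or after the reflection in the other value, so exchanging the
  two letters requires reflecting the value of the over-passing letter. This letter is \<open>C\<close> if over-passages come first, and \<open>A\<close> if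
  they come second. Of the two other pairs, one has two over-passages, which force equal values, and
  the other two under-passages, which shift the state by the difference of the values. The shift is
  the same in both words because of that equality and \<open>3 = 0\<close>.
\<close>

lemma run_move3:
  assumes "b A = b B" "b B = b C" "A \<noteq> B" "A \<noteq> C" "B \<noteq> C"
    "{A, B, C} \<inter> (set x \<union> set y \<union> set z \<union> set t) = {}"
    and c': "c' = (if b A then c(C := - c C - c A) else c(A := - c A - c C))"
  shows "run b c' {} (x @ [B, A] @ y @ [C, A] @ z @ [C, B] @ t) k =
    run b c {} (x @ [A, B] @ y @ [A, C] @ z @ [B, C] @ t) k"
proof -
  define X Y Z T where "X = run b c {} x" and "Y = run b c (set x) y"
    and "Z = run b c (set x \<union> set y) z" and "T = run b c (set x \<union> set y \<union> set z) t"
  have agree: "c' D = c D" if "D \<notin> {A, B, C}" for D using that c' by auto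
  have X: "run b c' {} x s = X s" "run b c {} x s = X s" for s
    unfolding X_def by (rule run_cong; use assms(6) agree in blast)+
  have Y: "run b c' S y s = Y s" "run b c S y s = Y s" if "S - {A, B, C} = set x" for S s
    unfolding Y_def by (rule run_cong; use that assms(6) agree in blast)+
  have Z: "run b c' S z s = Z s" "run b c S z s = Z s" if "S - {A, B, C} = set x \<union> set y" for S s
    unfolding Z_def by (rule run_cong; use that assms(6) agree in blast)+
  have T: "run b c' S t s = T s" "run b c S t s = T s"
    if "S - {A, B, C} = set x \<union> set y \<union> set z" for S s
    unfolding T_def by (rule run_cong; use that assms(6) agree in blast)+
  have sets: "insert B (insert A (set x)) - {A, B, C} = set x"
    "insert A (insert B (set x)) - {A, B, C} = set x"
    "insert C (insert A (insert B (insert A (set x)) \<union> set y)) - {A, B, C} = set x \<union> set y"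
    "insert A (insert C (insert A (insert B (set x)) \<union> set y)) - {A, B, C} = set x \<union> set y"
    "insert C (insert B (insert C (insert A (insert B (insert A (set x)) \<union> set y)) \<union> set z))
      - {A, B, C} = set x \<union> set y \<union> set z"
    "insert B (insert C (insert A (insert C (insert A (insert B (set x)) \<union> set y)) \<union> set z))
      - {A, B, C} = set x \<union> set y \<union> set z"
    using assms(6) by auto
  have notin: "A \<notin> set x" "B \<notin> set x" "C \<notin> set x" "A \<notin> set y" "B \<notin> set y" "C \<notin> set y"
    "A \<notin> set z" "B \<notin> set z" "C \<notin> set z" using assms(6) by auto
  show ?thesis
  proof (cases "b A")
    case True
    have b: "b A" "b B" "b C" using True assms(1,2) by auto
    have cs: "c' A = c A" "c' B = c B" "c' C = - c C - c A" using c' b assms(3-5) by auto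
    have old: "run b c {} (x @ [A, B] @ y @ [A, C] @ z @ [B, C] @ t) k =
      Option.bind (X k) (\<lambda>u. if u = c A \<and> u = c B then
        Option.bind (Y u) (\<lambda>s. if - s - c A = c C then
          Option.bind (Z (c C)) (\<lambda>r. T (- (- r - c B) - c C)) else None) else None)"
      using assms(3-5) notin
      by (auto simp: run_append X b sets Y Z T intro!: Option.bind_cong split: bind_splits)
    have new: "run b c' {} (x @ [B, A] @ y @ [C, A] @ z @ [C, B] @ t) k =
      Option.bind (X k) (\<lambda>u. if u = c A \<and> u = c B then
        Option.bind (Y u) (\<lambda>s. if s = - c C - c A then
          Option.bind (Z (- s - c A)) (\<lambda>r. T (- (- r - (- c C - c A)) - c B)) else None) else None)"
      using assms(3-5) notin
      by (auto simp: run_append X b sets Y Z T cs intro!: Option.bind_cong split: bind_splits)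
    (* The shift caused by the under-passages of B and C; here a is the common value of A and B. *)
    have eq: "- (- r - (- c C - a)) - a = - (- r - a) - c C" for r a
    proof -
      have "- (- r - (- c C - a)) - a = - (- r - a) - c C - (a + a + a)"
        by (simp add: algebra_simps)
      then show ?thesis by (simp only: triple_eq_0 diff_0_right)
    qed
    have cancel: "- (- r - a) - a = r" for r a :: 3 by simp
    show ?thesis unfolding old new
      by (intro Option.bind_cong refl if_cong) (auto simp only: neg_diff_eq_iff eq cancel)
  next
    case False
    have b: "\<not> b A" "\<not> b B" "\<not> b C" using False assms(1,2) by auto
    have cs: "c' A = - c A - c C" "c' B = c B" "c' C = c C" using c' b assms(3-5) by auto
    have old: "run b c {} (x @ [A, B] @ y @ [A, C] @ z @ [B, C] @ t) k =
      Option.bind (X k) (\<lambda>u. Option.bind (Y (- (- u - c A) - c B)) (\<lambda>s. if s = c A then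
          Option.bind (Z (- s - c C)) (\<lambda>r. if r = c B \<and> r = c C then T r else None) else None))"
      using assms(3-5) notin
      by (auto simp: run_append X b sets Y Z T intro!: Option.bind_cong split: bind_splits)
    have new: "run b c' {} (x @ [B, A] @ y @ [C, A] @ z @ [C, B] @ t) k =
      Option.bind (X k) (\<lambda>u. Option.bind (Y (- (- u - c B) - (- c A - c C))) (\<lambda>s.
         if - s - c C = - c A - c C then
          Option.bind (Z (- c A - c C)) (\<lambda>r. if r = c B \<and> r = c C then T r else None) else None))"
      using assms(3-5) notin
      by (auto simp: run_append X b sets Y Z T cs intro!: Option.bind_cong split: bind_splits)
    have cancel: "- (- r - a) - a = r" for r a :: 3 by simp
    (* The shift caused by the under-passages of A and B; here a is the common value of B and C. *)
    have eq: "- (- u - a) - (- c A - a) = - (- u - c A) - a" for u a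
      using triple_eq_0[of a] by (simp add: algebra_simps)
    (* If B and C have different values, both readings fail at their over-passages. *)
    show ?thesis
    proof (cases "c B = c C")
      case True
      then show ?thesis unfolding old new
        by (intro Option.bind_cong refl if_cong) (auto simp only: neg_diff_eq_iff eq cancel)
    next
      case False
      then have "\<not> (r = c B \<and> r = c C)" for r by auto
      then show ?thesis unfolding old new by (auto split: bind_splits if_splits)
    qed
  qed
qed

text \<open>
  If the values on \<open>D\<close> are prescribed in terms of the values off \<open>D\<close>, restriction to \<open>L - D\<close> loses no
  information. This is the counting principle behind the first two moves, with \<open>D\<close> the set of
  removed letters.
\<close>

lemma card_forced_extensions:
  fixes Q :: "('l \<Rightarrow> 3) \<Rightarrow> bool"
  assumes "D \<subseteq> L"
    and Q: "\<And>c c'. (\<And>A. A \<in> L - D \<Longrightarrow> c A = c' A) \<Longrightarrow> Q c \<longleftrightarrow> Q c'"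
    and v: "\<And>c c'. (\<And>A. A \<in> L - D \<Longrightarrow> c A = c' A) \<Longrightarrow> v c = v c'"
  shows "card {c \<in> L \<rightarrow>\<^sub>E UNIV. Q c \<and> (\<forall>d\<in>D. c d = v c)} = card {c \<in> (L - D) \<rightarrow>\<^sub>E UNIV. Q c}"
proof -
  let ?r = "\<lambda>c. restrict c (L - D)" and ?e = "\<lambda>c A. if A \<in> D then v c else c A"
  let ?S = "{c \<in> L \<rightarrow>\<^sub>E UNIV. Q c \<and> (\<forall>d\<in>D. c d = v c)}"
    and ?S' = "{c \<in> (L - D) \<rightarrow>\<^sub>E UNIV. Q c}"
  have r: "Q (?r c) = Q c" "v (?r c) = v c" for c
    by (rule Q v; simp)+
  have e: "Q (?e c) = Q c" "v (?e c) = v c" for c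
    by (rule Q v; simp)+
  have "bij_betw ?r ?S ?S'"
  proof (rule bij_betw_byWitness[where f' = ?e])
    show "\<forall>c\<in>?S. ?e (?r c) = c"
      using r by (auto simp: fun_eq_iff PiE_iff extensional_def)
    show "\<forall>c\<in>?S'. ?r (?e c) = c"
      by (auto simp: fun_eq_iff PiE_iff extensional_def)
    show "?r ` ?S \<subseteq> ?S'" using r by auto
    show "?e ` ?S' \<subseteq> ?S" using e \<open>D \<subseteq> L\<close> by (auto simp: PiE_iff extensional_def)
  qed
  then show ?thesis by (rule bij_betw_same_card)
qed

lemma card_assignments_forced:
  assumes D: "D \<subseteq> L" "set w' \<union> set u \<subseteq> L - D"
    and w: "\<And>c. run b c {} w k = Some l \<longleftrightarrow>
      run b c {} w' k = Some l \<and> (\<forall>d\<in>D. c d = the (run b c {} u k))"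
  shows "card (assignments b L w k l) = card (assignments b (L - D) w' k l)"
  unfolding assignments_def w
proof (rule card_forced_extensions)
  fix c c' :: "'a \<Rightarrow> 3" assume *: "\<And>A. A \<in> L - D \<Longrightarrow> c A = c' A"
  show "run b c {} w' k = Some l \<longleftrightarrow> run b c' {} w' k = Some l"
    using D * by (subst run_cong[where c' = c']) auto
  show "the (run b c {} u k) = the (run b c' {} u k)"
    using D * by (subst run_cong[where c' = c']) auto
qed (fact D)

lemma card_assignments_move3:
  assumes "b A = b B" "b B = b C" "A \<noteq> B" "A \<noteq> C" "B \<noteq> C" "A \<in> L" "C \<in> L"
    "{A, B, C} \<inter> (set x \<union> set y \<union> set z \<union> set t) = {}"
  shows "card (assignments b L (x @ [A, B] @ y @ [A, C] @ z @ [B, C] @ t) k l) =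
    card (assignments b L (x @ [B, A] @ y @ [C, A] @ z @ [C, B] @ t) k l)"
proof -
  define T where "T = (\<lambda>c :: 'a \<Rightarrow> 3. if b A then c(C := - c C - c A) else c(A := - c A - c C))"
  let ?w = "x @ [A, B] @ y @ [A, C] @ z @ [B, C] @ t"
  let ?w' = "x @ [B, A] @ y @ [C, A] @ z @ [C, B] @ t"
  have inv: "T (T c) = c" for c :: "'a \<Rightarrow> 3"
    using assms by (auto simp: T_def fun_eq_iff)
  have run: "run b (T c) {} ?w' k = run b c {} ?w k" for c
    by (rule run_move3) (use assms in \<open>auto simp: T_def\<close>)
  have run': "run b (T c) {} ?w k = run b c {} ?w' k" for c
    using run[of "T c"] unfolding inv by simp
  have PiE: "T c \<in> L \<rightarrow>\<^sub>E UNIV" if "c \<in> L \<rightarrow>\<^sub>E UNIV" for c :: "'a \<Rightarrow> 3"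
    using that assms by (auto simp: T_def PiE_iff extensional_def)
  have "bij_betw T (assignments b L ?w k l) (assignments b L ?w' k l)"
    by (rule bij_betw_byWitness[where f' = T])
      (auto simp: inv assignments_def run run' simp del: append.simps intro!: PiE)
  then show ?thesis by (rule bij_betw_same_card)
qed

section \<open>Invariance\<close>

text \<open>
  The conditions on a tricoloring mention letters only through the positions they occupy and the side
  of \<open>\<beta>\<close> on which they lie, and a relabelling preserves both.
\<close>

lemma tricolorings_iso:
  assumes "is_nanoword \<alpha> N" "nanoword_iso N M"
  shows "tricolorings \<alpha> \<beta> M k l = tricolorings \<alpha> \<beta> N k l"
proof -
  obtain h where h: "bij_betw h (letters N) (letters M)"
    "\<And>A. A \<in> letters N \<Longrightarrow> proj M (h A) = proj N A" "word M = map h (word N)"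
    using assms(2) unfolding nanoword_iso_def by blast
  have M: "letters M = h ` letters N" and inj: "inj_on h (letters N)"
    using h(1) by (auto simp: bij_betw_def)
  have nth: "map h (word N) ! (i - 1) = h A \<longleftrightarrow> word N ! (i - 1) = A"
    if "A \<in> letters N" "i \<in> {1..length (word N)}" for A i
  proof -
    have i: "i - 1 < length (word N)" using that by auto
    then have "word N ! (i - 1) \<in> letters N"
      using assms(1) nth_mem unfolding is_nanoword_def by blast
    then show ?thesis using i inj that(1) by (auto simp: inj_on_def)
  qed
  have "is_tricoloring \<alpha> \<beta> M f \<longleftrightarrow> is_tricoloring \<alpha> \<beta> N f" for f
    unfolding is_tricoloring_def M h(3) length_map ball_simps
    by (intro ball_cong refl) (simp add: nth h(2) del: One_nat_def)
  then show ?thesis by (simp add: tricolorings_def h(3))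
qed

lemma homotopy_step_card_tricolorings:
  assumes step: "homotopy_step \<alpha> \<tau> N M"
    and "involution_on \<alpha> \<tau>" "\<tau> ` \<beta> = \<beta>"
  shows "card (tricolorings \<alpha> \<beta> N k l) = card (tricolorings \<alpha> \<beta> M k l)"
  using step
proof cases
  case iso
  then show ?thesis by (simp add: tricolorings_iso)
next
  case (move1 L p x A y)
  have M: "is_nanoword \<alpha> M"
    using move1 by (auto simp: is_nanoword_def split: if_splits)
  have "A \<notin> set x" "A \<notin> set y" using move1 by auto
  from run_move1[OF this] have
    "card (assignments (\<lambda>A. p A \<in> \<beta>) L (x @ [A, A] @ y) k l) =
     card (assignments (\<lambda>A. p A \<in> \<beta>) (L - {A}) (x @ y) k l)"
    using move1 by (intro card_assignments_forced[where u = x]) auto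
  then show ?thesis
    using card_tricolorings[OF M] card_tricolorings[of \<alpha> N] move1 by simp
next
  case (move2 L p x A B y z)
  have M: "is_nanoword \<alpha> M"
    using move2 by (auto simp: is_nanoword_def split: if_splits)
  have "p B \<in> \<alpha>" using move2 by (simp add: is_nanoword_def)
  then have "p A \<in> \<beta> \<longleftrightarrow> p B \<in> \<beta>"
    using move2 assms(2,3) unfolding involution_on_def by (metis imageI)
  moreover have "A \<notin> set x \<union> set y \<union> set z" "B \<notin> set x \<union> set y \<union> set z" using move2 by auto
  ultimately have
    "card (assignments (\<lambda>A. p A \<in> \<beta>) L (x @ [A, B] @ y @ [B, A] @ z) k l) =
     card (assignments (\<lambda>A. p A \<in> \<beta>) (L - {A, B}) (x @ y @ z) k l)"
    using move2
    by (intro card_assignments_forced[OF _ _ run_move2]) (auto split: if_splits)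
  then show ?thesis
    using card_tricolorings[OF M] card_tricolorings[of \<alpha> N] move2 by simp
next
  case (move3 L p x A B y C z t)
  have M: "is_nanoword \<alpha> M"
  proof -
    have "set (word M) = set (word N)" unfolding move3(1,2) by auto
    moreover have "count_list (word M) D = count_list (word N) D" for D
      unfolding move3(1,2) by simp
    moreover have "letters M = letters N" "proj M = proj N" unfolding move3(1,2) by simp_all
    ultimately show ?thesis using move3(1,3) unfolding is_nanoword_def by simp
  qed
  have
    "card (assignments (\<lambda>A. p A \<in> \<beta>) L (x @ [A, B] @ y @ [A, C] @ z @ [B, C] @ t) k l) =
     card (assignments (\<lambda>A. p A \<in> \<beta>) L (x @ [B, A] @ y @ [C, A] @ z @ [C, B] @ t) k l)"
    using move3 by (intro card_assignments_move3) auto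
  then show ?thesis
    using card_tricolorings[OF M] card_tricolorings[of \<alpha> N] move3 by simp
qed

theorem theorem7p1:
  fixes \<alpha> \<beta> :: "'c set" and \<tau> :: "'c \<Rightarrow> 'c"
    and k l :: 3
    and N M :: "('l, 'c) nanoword"
  assumes "involution_on \<alpha> \<tau>"
    and "\<beta> \<subseteq> \<alpha>" and "\<tau> ` \<beta> = \<beta>"
    and "is_nanoword \<alpha> N" and "is_nanoword \<alpha> M"
    and "homotopic \<alpha> \<tau> N M"
  shows "card (tricolorings \<alpha> \<beta> N k l) = card (tricolorings \<alpha> \<beta> M k l)"
proof -
  have "equivclp (homotopy_step \<alpha> \<tau>) N M" using assms(6) by (simp add: homotopic_def)
  then show ?thesis
  proof (induction rule: equivclp_induct)
    case (step M M')
    then show ?case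
      using homotopy_step_card_tricolorings[OF _ assms(1,3)] by metis
  qed simp
qed

end
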